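(* Let $q,a,b,c,b',c',b'',c''$ be nonzero complex numbers with $|q|<1$, such that no denominator appearing below vanishes. Let $(\alpha_m)_{m\ge0}$ and $(\beta_{(n,l,k)})_{n,l,k\ge0}$ be complex sequences such that for all $n,l,k\ge0$ $$\beta_{(n,l,k)}=\sum_{m=0}^{\min(n,l,k)}\frac{\alpha_m}{(q;q)_{n-m}(q;q)_{l-m}(q;q)_{k-m}(aq;q)_{n+m}(aq;q)_{l+m}(aq;q)_{k+m}}.$$ Define, for $m\ge0$, $$\alpha'_m=\frac{(b,c,b',c',b'',c'';q)_m}{(qa/b,\,qa/c,\,qa/b',\,qa/c',\,qa/b'',\,qa/c'';q)_m}\left(\frac{a^3q^3}{bcb'c'b''c''}\right)^m\alpha_m,$$ and, for $N,L,K\ge0$, $$\beta'_{(N,L,K)}=\sum_{n=0}^{N}\sum_{l=0}^{L}\sum_{k=0}^{K}\frac{(b,c;q)_n\,(qa/(bc);q)_{N-n}\left(\frac{qa}{bc}\right)^n}{(qa/b,\,qa/c;q)_N\,(q;q)_{N-n}}\cdot\frac{(b',c';q)_l\,(qa/(b'c');q)_{L-l}\left(\frac{qa}{b'c'}\right)^l}{(qa/b',\,qa/c';q)_L\,(q;q)_{L-l}}$$ $$\times\frac{(b'',c'';q)_k\,(qa/(b''c'');q)_{K-k}\left(\frac{qa}{b''c''}\right)^k}{(qa/b'',\,qa/c'';q)_K\,(q;q)_{K-k}}\;\beta_{(n,l,k)}.$$ Then for all $n,l,k\ge0$ $$\beta'_{(n,l,k)}=\sum_{m=0}^{\min(n,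l,k)}\frac{\alpha'_m}{(q;q)_{n-m}(q;q)_{l-m}(q;q)_{k-m}(aq;q)_{n+m}(aq;q)_{l+m}(aq;q)_{k+m}}.$$
   Context: Notation: $(x;q)_n=\prod_{j=0}^{n-1}(1-xq^j)$ for integers $n\ge0$, and $(x_1,\dots,x_r;q)_n=\prod_{i}(x_i;q)_n$. *)

theory Defs
  imports Complex_Main
begin

definition qpoch :: "complex \<Rightarrow> complex \<Rightarrow> nat \<Rightarrow> complex" where
  "qpoch x q n = (\<Prod>j<n. 1 - x * q ^ j)"

text \<open>The multi-parameter symbol: \<open>qpochs [x\<^sub>1, \<dots>, x\<^sub>r] q n\<close> is the product of the
  \<open>qpoch x\<^sub>i q n\<close>.\<close>

definition qpochs :: "complex list \<Rightarrow> complex \<Rightarrow> nat \<Rightarrow> complex" where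
  "qpochs xs q n = (\<Prod>x\<leftarrow>xs. qpoch x q n)"

end

(* The kernel of the transformation factors over the three indices, so after exchanging the
   order of summation only a one-index sum remains. Shifting that sum by m turns it into the
   q-Pfaff-Saalschuetz summation with parameters b q^m, c q^m and a q^(2m+1). The summation itself
   is proved by creative telescoping, after clearing its denominators by the substitution
   z = w x y. *)

theory Submission
  imports Defs
begin

section \<open>q-Pochhammer symbols\<close>

lemma qpoch_0 [simp]: "qpoch x q 0 = 1"
  by (simp add: qpoch_def)

lemma qpoch_Suc: "qpoch x q (Suc n) = qpoch x q n * (1 - x * q ^ n)"
  by (simp add: qpoch_def)

lemma qpoch_Suc_left: "qpoch x q (Suc n) = (1 - x) * qpoch (x * q) q n"
  by (induction n) (simp_all add: qpoch_Suc mult.assoc)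

lemma qpoch_add: "qpoch x q (m + n) = qpoch x q m * qpoch (x * q ^ m) q n"
  by (induction n) (simp_all add: qpoch_Suc power_add mult.assoc)

lemma qpochs_Nil [simp]: "qpochs [] q n = 1"
  by (simp add: qpochs_def)

lemma qpochs_Cons [simp]: "qpochs (x # xs) q n = qpoch x q n * qpochs xs q n"
  by (simp add: qpochs_def)

lemma one_minus_power_Suc_nonzero:
  fixes q :: complex
  assumes "norm q < 1"
  shows "1 - q ^ Suc n \<noteq> 0"
proof
  assume "1 - q ^ Suc n = 0"
  then have "norm q ^ Suc n = 1"
    by (metis eq_iff_diff_eq_0 norm_one norm_power)
  then show False
    using power_decreasing[of 1 "Suc n" "norm q"] assms by simp
qed

lemma qpoch_q_q_nonzero:
  assumes "norm q < 1"
  shows "qpoch q q n \<noteq> 0"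
  using one_minus_power_Suc_nonzero[OF assms] by (induction n) (simp_all add: qpoch_Suc)

section \<open>The q-Pfaff-Saalschuetz summation\<close>

text \<open>With \<open>z = w * x * y\<close> this is the q-Pfaff-Saalschuetz summand times
  \<open>qpoch z q (j + d)\<close>: the quotient by \<open>qpoch z q j\<close> becomes the last
  Pochhammer factor, so only denominators in q remain. The index \<open>d\<close> stands for
  \<open>M - j\<close>.\<close>

definition saal_term :: "complex \<Rightarrow> complex \<Rightarrow> complex \<Rightarrow> complex \<Rightarrow> nat \<Rightarrow> nat \<Rightarrow> complex" where
  "saal_term q x y w j d =
    qpoch x q j * qpoch y q j * qpoch w q d * w ^ j * qpoch (w * x * y * q ^ j) q d /
      (qpoch q q j * qpoch q q d)"

text \<open>The induction step of \<open>saal_telescope\<close>, with \<open>t = q ^ J\<close>, \<open>s = q ^ d\<close>, \<open>M = Suc (J + d)\<close>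
  and the common factor of the summands cancelled.\<close>

lemma saal_certificate:
  fixes q x y w t s :: complex
  assumes "1 - q * t \<noteq> 0" "1 - q * s \<noteq> 0"
  shows
   "- (w * (q * s) * ((1 - x * t) * (1 - y * t)) *
        ((1 - w * s) * (1 - w * x * y * t) / (1 - q * s)))
    + ((1 - q * (q * t * s)) *
        ((1 - x * t) * (1 - y * t) * w * (1 - w * s) * (1 - w * x * y * (q * t * s)) /
          ((1 - q * t) * (1 - q * s)))
       - (1 - w * y * (q * t * s)) * (1 - w * x * (q * t * s)) *
          ((1 - x * t) * (1 - y * t) * w / (1 - q * t)))
    = - (w * s * ((1 - x * (q * t)) * (1 - y * (q * t))) *
        ((1 - x * t) * (1 - y * t) * w / (1 - q * t)))"
  using assms by (simp add: divide_simps) algebra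

text \<open>Creative telescoping for a first-order recurrence in \<open>M\<close>: each summand on
  the left is a difference of consecutive values of the right side, which vanishes before
  \<open>J = 0\<close>. The bound \<open>J \<le> M\<close> keeps \<open>M - j\<close> a true
  difference.\<close>

lemma saal_telescope:
  assumes q: "norm q < 1"
  shows "J \<le> M \<Longrightarrow>
    (\<Sum>j\<le>J. (1 - q ^ Suc M) * saal_term q x y w j (Suc M - j)
      - (1 - w * y * q ^ M) * (1 - w * x * q ^ M) * saal_term q x y w j (M - j))
    = - (w * q ^ (M - J) * ((1 - x * q ^ J) * (1 - y * q ^ J)) * saal_term q x y w J (M - J))"
proof (induction J)
  case 0
  have nz: "1 - q * q ^ M \<noteq> 0"
    using one_minus_power_Suc_nonzero[OF q, of M] by simp
  \<comment> \<open>The factors gained by raising \<open>d\<close>, minus those of the recurrence,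
    leave \<open>- w * q ^ M * (1 - x) * (1 - y)\<close>.\<close>
  have "(1 - q * q ^ M) * saal_term q x y w 0 (Suc M)
      = saal_term q x y w 0 M * ((1 - w * q ^ M) * (1 - w * x * y * q ^ M))"
    using nz by (simp add: saal_term_def qpoch_Suc)
  then show ?case by (simp add: algebra_simps)
next
  case (Suc J)
  define d where "d = M - Suc J"
  have M: "M = Suc (J + d)" using Suc.prems by (simp add: d_def)
  define t s where "t = q ^ J" and "s = q ^ d"
  \<comment> \<open>The part shared by the terms at \<open>(J, Suc d)\<close>,
    \<open>(Suc J, d)\<close> and \<open>(Suc J, Suc d)\<close>. Its last Pochhammer factor starts
    at \<open>q ^ Suc J\<close>, so in the first of these terms a factor has to be split off on the
    left.\<close>
  define P where "P = qpoch x q J * qpoch y q J * qpoch w q d * w ^ J *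
    qpoch (w * x * y * q ^ Suc J) q d / (qpoch q q J * qpoch q q d)"
  have nz: "1 - q * t \<noteq> 0" "1 - q * s \<noteq> 0"
    using one_minus_power_Suc_nonzero[OF q] by (auto simp: t_def s_def)
  have qM: "q ^ M = q * t * s" by (simp add: M t_def s_def power_add)
  have h1: "saal_term q x y w J (Suc d) =
      P * ((1 - w * s) * (1 - w * x * y * t) / (1 - q * s))"
    unfolding saal_term_def P_def qpoch_Suc_left[of "w * x * y * q ^ J"]
    by (simp add: qpoch_Suc s_def t_def ac_simps)
  have h2: "saal_term q x y w (Suc J) d =
      P * ((1 - x * t) * (1 - y * t) * w / (1 - q * t))"
    by (simp add: saal_term_def P_def qpoch_Suc s_def t_def ac_simps)
  have h3: "saal_term q x y w (Suc J) (Suc d) =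
      P * ((1 - x * t) * (1 - y * t) * w * (1 - w * s) * (1 - w * x * y * (q * t * s)) /
          ((1 - q * t) * (1 - q * s)))"
    by (simp add: saal_term_def P_def qpoch_Suc s_def t_def ac_simps)
  have d: "M - J = Suc d" "M - Suc J = d" "Suc M - Suc J = Suc d"
    by (simp_all add: M)
  have IH: "(\<Sum>j\<le>J. (1 - q ^ Suc M) * saal_term q x y w j (Suc M - j)
      - (1 - w * y * q ^ M) * (1 - w * x * q ^ M) * saal_term q x y w j (M - j))
    = - (w * (q * s) * ((1 - x * t) * (1 - y * t)) * saal_term q x y w J (Suc d))"
    using Suc by (simp add: d t_def s_def)
  have "(\<Sum>j\<le>Suc J. (1 - q ^ Suc M) * saal_term q x y w j (Suc M - j)
      - (1 - w * y * q ^ M) * (1 - w * x * q ^ M) * saal_term q x y w j (M - j))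
    = - (w * (q * s) * ((1 - x * t) * (1 - y * t)) * saal_term q x y w J (Suc d))
      + ((1 - q * (q * t * s)) * saal_term q x y w (Suc J) (Suc d)
        - (1 - w * y * (q * t * s)) * (1 - w * x * (q * t * s)) * saal_term q x y w (Suc J) d)"
    unfolding sum.atMost_Suc IH by (simp only: d qM power_Suc)
  also have "\<dots> = P * (- (w * (q * s) * ((1 - x * t) * (1 - y * t)) *
        ((1 - w * s) * (1 - w * x * y * t) / (1 - q * s)))
    + ((1 - q * (q * t * s)) *
        ((1 - x * t) * (1 - y * t) * w * (1 - w * s) * (1 - w * x * y * (q * t * s)) /
          ((1 - q * t) * (1 - q * s)))
       - (1 - w * y * (q * t * s)) * (1 - w * x * (q * t * s)) *
          ((1 - x * t) * (1 - y * t) * w / (1 - q * t))))"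
    unfolding h1 h2 h3 by (simp only: distrib_left right_diff_distrib mult_minus_right ac_simps)
  also have "\<dots> = - (w * s * ((1 - x * (q * t)) * (1 - y * (q * t))) * saal_term q x y w (Suc J) d)"
    unfolding saal_certificate[OF nz] h2 by (simp only: mult_minus_right ac_simps)
  finally show ?case by (simp add: d t_def s_def)
qed

text \<open>The telescoped identity at \<open>J = M\<close> turns into a first-order recurrence for
  the sum, whose iteration builds up the two products. No condition on \<open>x\<close>,
  \<open>y\<close>, \<open>w\<close> arises, since only powers of q are divided by.\<close>

lemma q_saalschuetz_poly:
  assumes q: "norm q < 1"
  shows "qpoch q q M * (\<Sum>j\<le>M. saal_term q x y w j (M - j)) = qpoch (w * x) q M * qpoch (w * y) q M"
proof (induction M)
  case 0
  show ?case by (simp add: saal_term_def)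
next
  case (Suc M)
  let ?S = "\<lambda>M. \<Sum>j\<le>M. saal_term q x y w j (M - j)"
  have nz: "1 - q * q ^ M \<noteq> 0"
    using one_minus_power_Suc_nonzero[OF q, of M] by simp
  \<comment> \<open>The new sum has one term beyond the telescoped range, \<open>j = Suc M\<close>;
    it cancels the boundary value at \<open>J = M\<close>.\<close>
  have top: "(1 - q ^ Suc M) * saal_term q x y w (Suc M) 0
      = w * ((1 - x * q ^ M) * (1 - y * q ^ M)) * saal_term q x y w M 0"
    using nz by (simp add: saal_term_def qpoch_Suc)
  have "(1 - q ^ Suc M) * (\<Sum>j\<le>M. saal_term q x y w j (Suc M - j))
      - (1 - w * y * q ^ M) * (1 - w * x * q ^ M) * ?S M
      = - (w * ((1 - x * q ^ M) * (1 - y * q ^ M)) * saal_term q x y w M 0)"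
    using saal_telescope[OF q order_refl, of M x y w] by (simp add: sum_subtractf sum_distrib_left)
  then have "(1 - q ^ Suc M) * ?S (Suc M) = (1 - w * y * q ^ M) * (1 - w * x * q ^ M) * ?S M"
    unfolding sum.atMost_Suc distrib_left diff_self_eq_0 top by (simp only: diff_eq_eq) simp
  then have "qpoch q q (Suc M) * ?S (Suc M)
      = (1 - w * y * q ^ M) * (1 - w * x * q ^ M) * (qpoch q q M * ?S M)"
    by (simp add: qpoch_Suc)
  then show ?case unfolding Suc.IH by (simp add: qpoch_Suc)
qed

text \<open>The terminating balanced 3-phi-2 sum, with the Pochhammer symbols of its parameters
  \<open>q^(-M)\<close> and \<open>x y q^(1-M) / z\<close> reversed into symbols of length
  \<open>M - j\<close>. It is the polynomial form at \<open>w = z / (x * y)\<close>, divided by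
  \<open>qpoch z q M\<close>.\<close>

lemma q_saalschuetz:
  assumes q: "norm q < 1" and "x \<noteq> 0" "y \<noteq> 0" and z: "\<And>n. qpoch z q n \<noteq> 0"
  shows "(\<Sum>j\<le>M. qpoch x q j * qpoch y q j * qpoch (z / (x * y)) q (M - j) * (z / (x * y)) ^ j /
            (qpoch q q (M - j) * (qpoch q q j * qpoch z q j)))
    = qpoch (z / x) q M * qpoch (z / y) q M / (qpoch q q M * qpoch z q M)" (is "?L = _")
proof -
  let ?w = "z / (x * y)"
  have w: "?w * x * y = z" "?w * x = z / y" "?w * y = z / x"
    using assms by simp_all
  have "?L = (\<Sum>j\<le>M. saal_term q x y ?w j (M - j) / qpoch z q M)"
  proof (rule sum.cong[OF refl])
    fix j assume "j \<in> {..M}"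
    then have split: "qpoch z q M = qpoch z q j * qpoch (z * q ^ j) q (M - j)"
      using qpoch_add[of z q j "M - j"] by simp
    then have "qpoch (z * q ^ j) q (M - j) \<noteq> 0" using z[of M] by auto
    then show "qpoch x q j * qpoch y q j * qpoch ?w q (M - j) * ?w ^ j /
          (qpoch q q (M - j) * (qpoch q q j * qpoch z q j))
        = saal_term q x y ?w j (M - j) / qpoch z q M"
      unfolding saal_term_def w(1) split using z[of j] qpoch_q_q_nonzero[OF q]
      by (simp add: divide_simps)
  qed
  also have "\<dots> = (\<Sum>j\<le>M. saal_term q x y ?w j (M - j)) / qpoch z q M"
    by (simp add: sum_divide_distrib)
  also have "\<dots> = qpoch (z / x) q M * qpoch (z / y) q M / (qpoch q q M * qpoch z q M)"
    using q_saalschuetz_poly[OF q, of M x y ?w] z[of M] qpoch_q_q_nonzero[OF q, of M]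
    unfolding w by (simp add: field_simps)
  finally show ?thesis .
qed

section \<open>The Bailey transformation\<close>

text \<open>One of the three factors of the kernel relating \<alpha> to \<beta>. The value 0 for
  \<open>m > n\<close> replaces what truncated subtraction would give, so that m may range over a
  set independent of n.\<close>

definition bailey_kernel :: "complex \<Rightarrow> complex \<Rightarrow> nat \<Rightarrow> nat \<Rightarrow> complex" where
  "bailey_kernel q a n m =
    (if m \<le> n then 1 / (qpoch q q (n - m) * qpoch (a * q) q (n + m)) else 0)"

definition bailey_weight ::
  "complex \<Rightarrow> complex \<Rightarrow> complex \<Rightarrow> complex \<Rightarrow> nat \<Rightarrow> nat \<Rightarrow> complex" where
  "bailey_weight q a b c N n =
    qpochs [b, c] q n * qpoch (q * a / (b * c)) q (N - n) * (q * a / (b * c)) ^ n /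
      (qpochs [q * a / b, q * a / c] q N * qpoch q q (N - n))"

text \<open>The one-index Bailey lemma: weighting reproduces the kernel up to a factor depending on
  \<open>m\<close> alone, and this factor is one third of the passage from \<alpha> to
  \<alpha>'.\<close>

lemma bailey_weight_kernel_sum:
  assumes q: "norm q < 1" and nz: "q \<noteq> 0" "b \<noteq> 0" "c \<noteq> 0"
    and aq: "\<And>n. qpoch (a * q) q n \<noteq> 0"
    and bc: "\<And>n. qpochs [q * a / b, q * a / c] q n \<noteq> 0"
    and "m \<le> N"
  shows "(\<Sum>n = 0..N. bailey_weight q a b c N n * bailey_kernel q a n m) =
    qpochs [b, c] q m / qpochs [q * a / b, q * a / c] q m * (q * a / (b * c)) ^ m *
      bailey_kernel q a N m"
proof -
  define M where "M = N - m"
  have N: "N = M + m" using \<open>m \<le> N\<close> by (simp add: M_def)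
  \<comment> \<open>These are the bases left after splitting off \<open>m\<close> factors from the
    symbols of \<open>b\<close> and \<open>c\<close>, and \<open>2 * m\<close> factors from that of
    \<open>a * q\<close>. The powers of q cancel in \<open>z / (x * y)\<close>, which is why the
    weight's argument \<open>w\<close> does not depend on \<open>m\<close>.\<close>
  define x y z where "x = b * q ^ m" and "y = c * q ^ m" and "z = a * q * q ^ (2 * m)"
  define w where "w = q * a / (b * c)"
  have xy: "x \<noteq> 0" "y \<noteq> 0" using nz by (auto simp: x_def y_def)
  have zxy: "z / (x * y) = w" "z / x = q * a / b * q ^ m" "z / y = q * a / c * q ^ m"
    using nz by (simp_all add: x_def y_def z_def w_def power_add mult_2)
  have aq_split: "qpoch (a * q) q (2 * m + n) = qpoch (a * q) q (2 * m) * qpoch z q n" for n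
    by (simp add: qpoch_add z_def)
  have z: "qpoch z q n \<noteq> 0" for n
    using aq[of "2 * m + n"] aq_split[of n] by auto
  have den: "qpoch (q * a / b) q n \<noteq> 0" "qpoch (q * a / c) q n \<noteq> 0" for n
    using bc[of n] by auto
  have den_split: "qpoch (q * a / b) q N = qpoch (q * a / b) q m * qpoch (z / x) q M"
    "qpoch (q * a / c) q N = qpoch (q * a / c) q m * qpoch (z / y) q M"
    unfolding zxy N by (simp_all add: qpoch_add add.commute[of M])
  define D where "D = qpoch (q * a / b) q N * qpoch (q * a / c) q N"
  \<comment> \<open>Everything in the shifted summand that is free of \<open>j\<close>.\<close>
  define K where "K = qpoch b q m * qpoch c q m * w ^ m / (D * qpoch (a * q) q (2 * m))"
  have "(\<Sum>n = 0..N. bailey_weight q a b c N n * bailey_kernel q a n m)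
      = (\<Sum>n = 0 + m..M + m. bailey_weight q a b c N n * bailey_kernel q a n m)"
    \<comment> \<open>Terms with \<open>n < m\<close> vanish by the definition of the
      kernel.\<close>
    by (rule sum.mono_neutral_right) (auto simp: bailey_kernel_def N)
  also have "\<dots> = (\<Sum>j\<le>M. bailey_weight q a b c N (j + m) * bailey_kernel q a (j + m) m)"
    by (subst sum.shift_bounds_cl_nat_ivl) (simp add: atLeast0AtMost)
  also have "\<dots> = (\<Sum>j\<le>M. K * (qpoch x q j * qpoch y q j * qpoch (z / (x * y)) q (M - j) *
      (z / (x * y)) ^ j / (qpoch q q (M - j) * (qpoch q q j * qpoch z q j))))"
  proof (rule sum.cong[OF refl])
    fix j
    have s: "qpoch b q (j + m) = qpoch b q m * qpoch x q j"
      "qpoch c q (j + m) = qpoch c q m * qpoch y q j"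
      by (simp_all add: add.commute[of j] qpoch_add x_def y_def)
    have e: "j + m + m = 2 * m + j" "N - (j + m) = M - j" by (simp_all add: N)
    show "bailey_weight q a b c N (j + m) * bailey_kernel q a (j + m) m =
      K * (qpoch x q j * qpoch y q j * qpoch (z / (x * y)) q (M - j) *
      (z / (x * y)) ^ j / (qpoch q q (M - j) * (qpoch q q j * qpoch z q j)))"
      unfolding bailey_weight_def bailey_kernel_def zxy(1) K_def D_def w_def[symmetric] e aq_split
      by (simp add: s power_add ac_simps)
  qed
  also have "\<dots> = K * (qpoch (z / x) q M * qpoch (z / y) q M / (qpoch q q M * qpoch z q M))"
    unfolding sum_distrib_left[symmetric] q_saalschuetz[OF q xy z] ..
  also have "\<dots> = qpochs [b, c] q m / qpochs [q * a / b, q * a / c] q m * w ^ m *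
      bailey_kernel q a N m"
  proof -
    have e: "N + m = 2 * m + M" "N - m = M" by (simp_all add: N)
    have k: "bailey_kernel q a N m =
        1 / (qpoch q q M * (qpoch (a * q) q (2 * m) * qpoch z q M))"
      using \<open>m \<le> N\<close> unfolding bailey_kernel_def e aq_split by simp
    \<comment> \<open>The Saalschuetz numerators cancel the tails of the symbols of length
      \<open>N\<close> in \<open>D\<close>, leaving symbols of length \<open>m\<close>.\<close>
    have "qpoch (z / x) q M \<noteq> 0" "qpoch (z / y) q M \<noteq> 0"
      using den[of N] den_split by auto
    then show ?thesis
      unfolding k K_def D_def den_split by (simp add: ac_simps)
  qed
  finally show ?thesis unfolding w_def .
qed

text \<open>Gives the sum over m a range independent of n, l, k, as the exchange of summation
  requires: past the smallest of the three indices one kernel is zero.\<close>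

lemma bailey_kernel_triple_sum:
  assumes "n \<le> N" "l \<le> L" "k \<le> K"
  shows "(\<Sum>m = 0..min n (min l k). f m /
        (qpoch q q (n - m) * qpoch q q (l - m) * qpoch q q (k - m) *
         qpoch (a * q) q (n + m) * qpoch (a * q) q (l + m) * qpoch (a * q) q (k + m)))
    = (\<Sum>m = 0..min N (min L K).
        f m * (bailey_kernel q a n m * bailey_kernel q a l m * bailey_kernel q a k m))"
proof -
  have "(\<Sum>m = 0..min N (min L K).
        f m * (bailey_kernel q a n m * bailey_kernel q a l m * bailey_kernel q a k m))
    = (\<Sum>m = 0..min n (min l k).
        f m * (bailey_kernel q a n m * bailey_kernel q a l m * bailey_kernel q a k m))"
    using assms by (intro sum.mono_neutral_right) (auto simp: bailey_kernel_def)
  also have "\<dots> = (\<Sum>m = 0..min n (min l k). f m /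
        (qpoch q q (n - m) * qpoch q q (l - m) * qpoch q q (k - m) *
         qpoch (a * q) q (n + m) * qpoch (a * q) q (l + m) * qpoch (a * q) q (k + m)))"
    by (intro sum.cong refl) (simp add: bailey_kernel_def ac_simps)
  finally show ?thesis ..
qed

text \<open>The sum over m moves outward past k, l and n in turn; for fixed m the summand separates,
  so the triple sum is a product of three single sums.\<close>

lemma triple_sum_product:
  fixes u v w :: "nat \<Rightarrow> complex"
  shows "(\<Sum>n\<in>A. \<Sum>l\<in>B. \<Sum>k\<in>C. u n * v l * w k * (\<Sum>m\<in>R. f m * (x n m * y l m * z k m)))
    = (\<Sum>m\<in>R. f m * ((\<Sum>n\<in>A. u n * x n m) * (\<Sum>l\<in>B. v l * y l m) * (\<Sum>k\<in>C. w k * z k m)))"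
proof -
  have "(\<Sum>n\<in>A. \<Sum>l\<in>B. \<Sum>k\<in>C. u n * v l * w k * (\<Sum>m\<in>R. f m * (x n m * y l m * z k m)))
    = (\<Sum>n\<in>A. \<Sum>l\<in>B. \<Sum>k\<in>C. \<Sum>m\<in>R. f m * ((u n * x n m) * (v l * y l m) * (w k * z k m)))"
    by (simp add: sum_distrib_left ac_simps)
  also have "\<dots> = (\<Sum>n\<in>A. \<Sum>l\<in>B. \<Sum>m\<in>R. \<Sum>k\<in>C. f m * ((u n * x n m) * (v l * y l m) * (w k * z k m)))"
    by (intro sum.cong refl sum.swap)
  also have "\<dots> = (\<Sum>n\<in>A. \<Sum>m\<in>R. \<Sum>l\<in>B. \<Sum>k\<in>C. f m * ((u n * x n m) * (v l * y l m) * (w k * z k m)))"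
    by (intro sum.cong refl sum.swap)
  also have "\<dots> = (\<Sum>m\<in>R. \<Sum>n\<in>A. \<Sum>l\<in>B. \<Sum>k\<in>C. f m * ((u n * x n m) * (v l * y l m) * (w k * z k m)))"
    by (rule sum.swap)
  also have "\<dots> = (\<Sum>m\<in>R. f m * ((\<Sum>n\<in>A. u n * x n m) * (\<Sum>l\<in>B. v l * y l m) * (\<Sum>k\<in>C. w k * z k m)))"
    by (simp only: sum_distrib_left[symmetric] sum_distrib_right[symmetric])
  finally show ?thesis .
qed

theorem theorem5p1:
  fixes q a b c b' c' b'' c'' :: complex
    and \<alpha> \<alpha>' :: "nat \<Rightarrow> complex"
    and \<beta> \<beta>' :: "nat \<Rightarrow> nat \<Rightarrow> nat \<Rightarrow> complex"
  assumes nonzero: "q \<noteq> 0" "a \<noteq> 0" "b \<noteq> 0" "c \<noteq> 0" "b' \<noteq> 0" "c' \<noteq> 0" "b'' \<noteq> 0" "c'' \<noteq> 0"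
    and norm_q: "norm q < 1"
    and denom_aq: "\<And>n. qpoch (a * q) q n \<noteq> 0"
    and denom_b: "\<And>n. qpochs [q * a / b, q * a / c] q n \<noteq> 0"
    and denom_b': "\<And>n. qpochs [q * a / b', q * a / c'] q n \<noteq> 0"
    and denom_b'': "\<And>n. qpochs [q * a / b'', q * a / c''] q n \<noteq> 0"
    and beta: "\<And>n l k. \<beta> n l k =
      (\<Sum>m = 0..min n (min l k). \<alpha> m /
        (qpoch q q (n - m) * qpoch q q (l - m) * qpoch q q (k - m) *
         qpoch (a * q) q (n + m) * qpoch (a * q) q (l + m) * qpoch (a * q) q (k + m)))"
    and alpha': "\<And>m. \<alpha>' m =
      qpochs [b, c, b', c', b'', c''] q m /
      qpochs [q * a / b, q * a / c, q * a / b', q * a / c', q * a / b'', q * a / c''] q m *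
      (a ^ 3 * q ^ 3 / (b * c * b' * c' * b'' * c'')) ^ m * \<alpha> m"
    and beta': "\<And>N L K. \<beta>' N L K =
      (\<Sum>n = 0..N. \<Sum>l = 0..L. \<Sum>k = 0..K.
        (qpochs [b, c] q n * qpoch (q * a / (b * c)) q (N - n) * (q * a / (b * c)) ^ n /
          (qpochs [q * a / b, q * a / c] q N * qpoch q q (N - n))) *
        (qpochs [b', c'] q l * qpoch (q * a / (b' * c')) q (L - l) * (q * a / (b' * c')) ^ l /
          (qpochs [q * a / b', q * a / c'] q L * qpoch q q (L - l))) *
        (qpochs [b'', c''] q k * qpoch (q * a / (b'' * c'')) q (K - k) * (q * a / (b'' * c'')) ^ k /
          (qpochs [q * a / b'', q * a / c''] q K * qpoch q q (K - k))) *
        \<beta> n l k)"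
  shows "\<forall>n l k. \<beta>' n l k =
      (\<Sum>m = 0..min n (min l k). \<alpha>' m /
        (qpoch q q (n - m) * qpoch q q (l - m) * qpoch q q (k - m) *
         qpoch (a * q) q (n + m) * qpoch (a * q) q (l + m) * qpoch (a * q) q (k + m)))"
proof (intro allI)
  fix N L K :: nat
  let ?R = "{0..min N (min L K)}"
  let ?X = "bailey_kernel q a"
  let ?W = "bailey_weight q a b c N" and ?W' = "bailey_weight q a b' c' L"
    and ?W'' = "bailey_weight q a b'' c'' K"
  have "\<beta>' N L K = (\<Sum>n = 0..N. \<Sum>l = 0..L. \<Sum>k = 0..K. ?W n * ?W' l * ?W'' k *
      (\<Sum>m\<in>?R. \<alpha> m * (?X n m * ?X l m * ?X k m)))"
    unfolding beta' bailey_weight_def[symmetric]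
  proof (intro sum.cong refl)
    fix n l k assume "n \<in> {0..N}" "l \<in> {0..L}" "k \<in> {0..K}"
    then show "?W n * ?W' l * ?W'' k * \<beta> n l k
        = ?W n * ?W' l * ?W'' k * (\<Sum>m\<in>?R. \<alpha> m * (?X n m * ?X l m * ?X k m))"
      unfolding beta by (subst bailey_kernel_triple_sum) auto
  qed
  also have "\<dots> = (\<Sum>m\<in>?R. \<alpha> m * ((\<Sum>n = 0..N. ?W n * ?X n m) *
      (\<Sum>l = 0..L. ?W' l * ?X l m) * (\<Sum>k = 0..K. ?W'' k * ?X k m)))"
    by (rule triple_sum_product)
  also have "\<dots> = (\<Sum>m\<in>?R. \<alpha>' m * (?X N m * ?X L m * ?X K m))"
  proof (intro sum.cong refl)
    fix m assume "m \<in> ?R"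
    then have m: "m \<le> N" "m \<le> L" "m \<le> K" by auto
    \<comment> \<open>The power in \<alpha>' is shared out as one factor for each of the three
      one-index sums.\<close>
    have p: "(a ^ 3 * q ^ 3 / (b * c * b' * c' * b'' * c'')) ^ m =
        (q * a / (b * c)) ^ m * (q * a / (b' * c')) ^ m * (q * a / (b'' * c'')) ^ m"
      unfolding power_mult_distrib[symmetric] by (simp add: power3_eq_cube ac_simps)
    note S = bailey_weight_kernel_sum[OF norm_q nonzero(1) _ _ denom_aq]
    show "\<alpha> m * ((\<Sum>n = 0..N. ?W n * ?X n m) *
        (\<Sum>l = 0..L. ?W' l * ?X l m) * (\<Sum>k = 0..K. ?W'' k * ?X k m))
      = \<alpha>' m * (?X N m * ?X L m * ?X K m)"
      unfolding S[OF nonzero(3,4) denom_b m(1)] S[OF nonzero(5,6) denom_b' m(2)]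
        S[OF nonzero(7,8) denom_b'' m(3)] alpha' p
      by (simp only: qpochs_Cons qpochs_Nil mult_1_left mult_1_right times_divide_eq_left
        times_divide_eq_right divide_divide_eq_left ac_simps)
  qed
  also have "\<dots> = (\<Sum>m = 0..min N (min L K). \<alpha>' m /
        (qpoch q q (N - m) * qpoch q q (L - m) * qpoch q q (K - m) *
         qpoch (a * q) q (N + m) * qpoch (a * q) q (L + m) * qpoch (a * q) q (K + m)))"
    \<comment> \<open>Here the inner indices equal the outer bounds, so the lemma merely unfolds the
      kernels.\<close>
    by (rule bailey_kernel_triple_sum[symmetric]) simp_all
  finally show "\<beta>' N L K = (\<Sum>m = 0..min N (min L K). \<alpha>' m /
        (qpoch q q (N - m) * qpoch q q (L - m) * qpoch q q (K - m) *
         qpoch (a * q) q (N + m) * qpoch (a * q) q (L + m) * qpoch (a * q) q (K + m)))" .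
qed

end
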